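(* Let $f:[0,1]\to[0,1]$ be given by $f(\Delta^{3}_{\alpha_1\alpha_2\ldots\alpha_n\ldots})=\Delta^{3}_{\varphi(\alpha_1)\varphi(\alpha_2)\ldots\varphi(\alpha_n)\ldots}$, where $\varphi(0)=0$, $\varphi(1)=2$, $\varphi(2)=1$. Then $f$ is continuous at every ternary-irrational point of $[0,1]$, and every ternary-rational point is a point of discontinuity of $f$. Furthermore, if $x_0=\Delta^{3}_{\alpha_1\alpha_2\ldots\alpha_n000\ldots}$ is a ternary-rational point with $\alpha_n\neq 0$, then the one-sided limits of $f$ at $x_0$ exist and the jump $\lim_{x\to x_0+0}f(x)-\lim_{x\to x_0-0}f(x)$ equals $\frac{1}{2\cdot 3^{n-1}}$ if $\alpha_n=1$, and equals $-\frac{1}{2\cdot 3^{n-1}}$ if $\alpha_n=2$.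
   Context: For digits $\alpha_n\in\{0,1,2\}$, $\Delta^{3}_{\alpha_1\alpha_2\ldots\alpha_n\ldots}$ denotes $\sum_{n=1}^{\infty}\alpha_n 3^{-n}$. Every $x\in[0,1]$ is written using its ternary representation that does not end in an infinite string of 2's, except that $1$ is written as $\Delta^{3}_{222\ldots}$; thus each $x$ has exactly one admissible digit sequence, and it is this sequence that is used in the definition of $f$. A number is called ternary-rational if it has the form $\Delta^{3}_{\alpha_1\alpha_2\ldots\alpha_{n-1}\alpha_n000\ldots}=\Delta^{3}_{\alpha_1\alpha_2\ldots\alpha_{n-1}(\alpha_n-1)222\ldots}$ for some $n\ge 1$ with $\alpha_n\neq0$ (so it lies in $(0,1)$ and has two ternary representations); the other numbers of $[0,1]$ are called ternary-irrational. *)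

theory Defs
  imports "HOL-Analysis.Analysis"
begin

text \<open>
  Digit sequences are indexed from 0, whereas the customary notation
  \<open>\<Delta>\<^sup>3(\<alpha>\<^sub>1 \<alpha>\<^sub>2 \<dots>)\<close> starts at 1: the digit \<open>\<alpha>\<^sub>n\<close> (\<open>n \<ge> 1\<close>) is \<open>\<alpha> (n - 1)\<close>.
\<close>

definition ternary_digits :: "(nat \<Rightarrow> nat) \<Rightarrow> bool" where
  "ternary_digits \<alpha> \<longleftrightarrow> (\<forall>i. \<alpha> i \<in> {0, 1, 2})"

definition Delta3 :: "(nat \<Rightarrow> nat) \<Rightarrow> real" where
  "Delta3 \<alpha> = (\<Sum>i. real (\<alpha> i) / 3 ^ Suc i)"

definition admissible :: "(nat \<Rightarrow> nat) \<Rightarrow> bool" where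
  "admissible \<alpha> \<longleftrightarrow> ternary_digits \<alpha> \<and>
     (\<not> (\<exists>N. \<forall>i\<ge>N. \<alpha> i = 2) \<or> (\<forall>i. \<alpha> i = 2))"

text \<open>
  The description below is proper for \<open>x \<in> {0..1}\<close>, see \<open>ex1_admissible\<close>.
\<close>

definition digits_of :: "real \<Rightarrow> nat \<Rightarrow> nat" where
  "digits_of x = (THE \<alpha>. admissible \<alpha> \<and> Delta3 \<alpha> = x)"

definition digit_swap :: "nat \<Rightarrow> nat" where
  "digit_swap d = (if d = 0 then 0 else if d = 1 then 2 else 1)"

text \<open>Only the values of \<open>swap_f\<close> on \<open>{0..1}\<close> are meaningful.\<close>

definition swap_f :: "real \<Rightarrow> real" where
  "swap_f x = Delta3 (\<lambda>i. digit_swap (digits_of x i))"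

text \<open>
  \<open>\<alpha>\<close> is the expansion whose \<open>n\<close>-th digit (counted from 1) is its last nonzero one.
\<close>

definition terminates_at :: "(nat \<Rightarrow> nat) \<Rightarrow> nat \<Rightarrow> bool" where
  "terminates_at \<alpha> n \<longleftrightarrow> ternary_digits \<alpha> \<and> n \<ge> 1 \<and> \<alpha> (n - 1) \<noteq> 0 \<and> (\<forall>i\<ge>n. \<alpha> i = 0)"

text \<open>
  That such a number also has the expansion with last digit decreased by one and
  followed by 2s is automatic, see \<open>Delta3_second_expansion\<close>.
\<close>

definition ternary_rational :: "real \<Rightarrow> bool" where
  "ternary_rational x \<longleftrightarrow> (\<exists>\<alpha> n. terminates_at \<alpha> n \<and> x = Delta3 \<alpha>)"

definition ternary_irrational :: "real \<Rightarrow> bool" where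
  "ternary_irrational x \<longleftrightarrow> x \<in> {0..1} \<and> \<not> ternary_rational x"


lemma ternary_digits_le: "ternary_digits \<alpha> \<Longrightarrow> \<alpha> i \<le> 2"
  unfolding ternary_digits_def by (auto dest!: spec[of _ i])

lemma sums_twos: "(\<lambda>i. 2 / 3 ^ Suc i :: real) sums 1"
  using sums_mult[OF geometric_sums[of "1/3::real"], of "2/3"]
  by (simp add: power_divide field_simps)

lemma Delta3_twos: "(\<And>i. \<alpha> i = 2) \<Longrightarrow> Delta3 \<alpha> = 1"
  using sums_twos by (simp add: Delta3_def sums_iff)

lemma Delta3_term_le: "ternary_digits \<alpha> \<Longrightarrow> real (\<alpha> i) / 3 ^ Suc i \<le> 2 / 3 ^ Suc i"
  using ternary_digits_le[of \<alpha> i] by (intro divide_right_mono) auto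

lemma summable_Delta3: "ternary_digits \<alpha> \<Longrightarrow> summable (\<lambda>i. real (\<alpha> i) / 3 ^ Suc i)"
  using Delta3_term_le
  by (intro summable_comparison_test'[OF sums_summable[OF sums_twos], of 0]) auto

lemma Delta3_nonneg: "ternary_digits \<alpha> \<Longrightarrow> 0 \<le> Delta3 \<alpha>"
  unfolding Delta3_def by (intro suminf_nonneg summable_Delta3) auto

lemma Delta3_le_1: "ternary_digits \<alpha> \<Longrightarrow> Delta3 \<alpha> \<le> 1"
  unfolding Delta3_def sums_unique[OF sums_twos]
  by (intro suminf_le Delta3_term_le summable_Delta3 sums_summable[OF sums_twos])

lemma ternary_digits_Suc: "ternary_digits \<alpha> \<Longrightarrow> ternary_digits (\<lambda>i. \<alpha> (Suc i))"
  by (simp add: ternary_digits_def)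

lemma Delta3_Suc:
  assumes "ternary_digits \<alpha>"
  shows "Delta3 \<alpha> = real (\<alpha> 0) / 3 + Delta3 (\<lambda>i. \<alpha> (Suc i)) / 3"
proof -
  have "Delta3 (\<lambda>i. \<alpha> (Suc i)) / 3 = (\<Sum>i. real (\<alpha> (Suc i)) / 3 ^ Suc (Suc i))"
    unfolding Delta3_def
    by (subst suminf_divide[OF summable_Delta3[OF ternary_digits_Suc[OF assms]], symmetric])
       (simp add: field_simps)
  then show ?thesis
    using suminf_split_head[OF summable_Delta3[OF assms]] by (simp add: Delta3_def field_simps)
qed

lemma Delta3_eq_1D:
  assumes "ternary_digits \<alpha>" "Delta3 \<alpha> = 1"
  shows "\<alpha> i = 2"
  using assms
proof (induction i arbitrary: \<alpha>)
  case 0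
  then show ?case
    using Delta3_Suc[OF 0(1)] Delta3_le_1[OF ternary_digits_Suc[OF 0(1)]]
      ternary_digits_le[OF 0(1), of 0] by auto
next
  case (Suc i)
  have "Delta3 (\<lambda>i. \<alpha> (Suc i)) = 1"
    using Delta3_Suc[OF Suc.prems(1)] Suc.prems(2)
      Delta3_le_1[OF ternary_digits_Suc[OF Suc.prems(1)]]
      ternary_digits_le[OF Suc.prems(1), of 0] by auto
  with Suc.IH[OF ternary_digits_Suc[OF Suc.prems(1)]] show ?case by simp
qed

lemma Delta3_inj:
  assumes "ternary_digits \<alpha>" "\<not> (\<exists>N. \<forall>i\<ge>N. \<alpha> i = 2)"
    and "ternary_digits \<beta>" "\<not> (\<exists>N. \<forall>i\<ge>N. \<beta> i = 2)" and "Delta3 \<alpha> = Delta3 \<beta>"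
  shows "\<alpha> n = \<beta> n"
proof -
  have tl: "\<not> (\<exists>N. \<forall>i\<ge>N. \<gamma> (Suc i) = 2)" if "\<not> (\<exists>N. \<forall>i\<ge>N. \<gamma> i = 2)" for \<gamma> :: "nat \<Rightarrow> nat"
    using that by (metis Suc_le_D Suc_le_mono)
  have floor: "\<lfloor>3 * Delta3 \<gamma>\<rfloor> = int (\<gamma> 0)"
    if \<gamma>: "ternary_digits \<gamma>" "\<not> (\<exists>N. \<forall>i\<ge>N. \<gamma> i = 2)" for \<gamma>
  proof -
    have "Delta3 (\<lambda>i. \<gamma> (Suc i)) < 1"
      using Delta3_le_1[OF ternary_digits_Suc[OF \<gamma>(1)]]
        Delta3_eq_1D[OF ternary_digits_Suc[OF \<gamma>(1)]] tl[OF \<gamma>(2)] by force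
    then show ?thesis
      using Delta3_Suc[OF \<gamma>(1)] Delta3_nonneg[OF ternary_digits_Suc[OF \<gamma>(1)]]
      by (intro floor_unique) auto
  qed
  show ?thesis
    using assms
  proof (induction n arbitrary: \<alpha> \<beta>)
    case 0
    then show ?case using floor[of \<alpha>] floor[of \<beta>] by simp
  next
    case (Suc n)
    have "\<alpha> 0 = \<beta> 0" using Suc.prems floor[of \<alpha>] floor[of \<beta>] by simp
    then have "Delta3 (\<lambda>i. \<alpha> (Suc i)) = Delta3 (\<lambda>i. \<beta> (Suc i))"
      using Suc.prems Delta3_Suc[of \<alpha>] Delta3_Suc[of \<beta>] by simp
    then show ?case
      using Suc.IH[of "\<lambda>i. \<alpha> (Suc i)" "\<lambda>i. \<beta> (Suc i)"] Suc.prems tl ternary_digits_Suc by blast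
  qed
qed

lemma ex_admissible:
  assumes "0 \<le> x" "x < 1"
  shows "\<exists>\<alpha>. ternary_digits \<alpha> \<and> \<not> (\<exists>N. \<forall>i\<ge>N. \<alpha> i = 2) \<and> Delta3 \<alpha> = x"
proof -
  define y where "y n = ((\<lambda>t. frac (3 * t)) ^^ n) x" for n :: nat
  define \<alpha> where "\<alpha> n = nat \<lfloor>3 * y n\<rfloor>" for n
  have y_Suc: "y (Suc n) = frac (3 * y n)" for n by (simp add: y_def)
  have y: "0 \<le> y n \<and> y n < 1" for n
    by (cases n) (use assms in \<open>simp_all add: y_Suc frac_lt_1\<close>, simp_all add: y_def)
  have real_\<alpha>: "real (\<alpha> n) = 3 * y n - y (Suc n)" for n
    using y[of n] by (simp add: \<alpha>_def y_Suc frac_def)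
  have digits: "ternary_digits \<alpha>"
    unfolding ternary_digits_def
  proof
    fix i
    have "real (\<alpha> i) < 3" using real_\<alpha>[of i] y[of i] y[of "Suc i"] by linarith
    then show "\<alpha> i \<in> {0, 1, 2}" by auto
  qed
  have digits': "ternary_digits (\<lambda>i. \<alpha> (i + N))" for N
    using digits by (simp add: ternary_digits_def)
  have part: "(\<Sum>i<n. real (\<alpha> (i + N)) / 3 ^ Suc i) = y N - y (n + N) / 3 ^ n" for n N
    by (induction n) (simp_all add: real_\<alpha> field_simps)
  have y_eq: "Delta3 (\<lambda>i. \<alpha> (i + N)) = y N" for N
  proof -
    have "(\<lambda>n. y (n + N) / 3 ^ n) \<longlonglongrightarrow> 0"
    proof (rule tendsto_sandwich[of "\<lambda>_. 0" _ _ "\<lambda>n. (1 / 3) ^ n"])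
      show "\<forall>\<^sub>F n in sequentially. y (n + N) / 3 ^ n \<le> (1 / 3) ^ n"
        by (intro always_eventually allI)
           (use y in \<open>auto simp: power_one_over field_simps less_imp_le\<close>)
    qed (use y in \<open>auto intro!: LIMSEQ_power_zero\<close>)
    then have "(\<lambda>n. y N - y (n + N) / 3 ^ n) \<longlonglongrightarrow> y N - 0" by (intro tendsto_intros)
    then show ?thesis
      unfolding Delta3_def by (intro sums_unique[symmetric]) (simp add: sums_def part del: power_Suc)
  qed
  have "\<not> (\<exists>N. \<forall>i\<ge>N. \<alpha> i = 2)"
    using Delta3_twos[of "\<lambda>i. \<alpha> (i + N)" for N] y_eq y by (metis le_add2 less_irrefl)
  moreover have "Delta3 \<alpha> = x" using y_eq[of 0] by (simp add: y_def)
  ultimately show ?thesis using digits by blast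
qed

lemma ex1_admissible:
  assumes "x \<in> {0..1}"
  shows "\<exists>!\<alpha>. admissible \<alpha> \<and> Delta3 \<alpha> = x"
proof (cases "x = 1")
  case True
  show ?thesis
  proof (rule ex1I[of _ "\<lambda>_. 2"])
    show "admissible (\<lambda>_. 2) \<and> Delta3 (\<lambda>_. 2) = x"
      using True by (simp add: admissible_def ternary_digits_def Delta3_twos)
  qed (use True Delta3_eq_1D in \<open>auto simp: admissible_def\<close>)
next
  case False
  then obtain \<alpha> where \<alpha>: "ternary_digits \<alpha>" "\<not> (\<exists>N. \<forall>i\<ge>N. \<alpha> i = 2)" "Delta3 \<alpha> = x"
    using ex_admissible[of x] assms by auto
  show ?thesis
  proof (rule ex1I[of _ \<alpha>])
    fix \<beta> assume \<beta>: "admissible \<beta> \<and> Delta3 \<beta> = x"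
    then have "\<not> (\<forall>i. \<beta> i = 2)" using False Delta3_twos by blast
    then show "\<beta> = \<alpha>" using \<beta> \<alpha> Delta3_inj[of \<beta> \<alpha>] by (auto simp: admissible_def)
  qed (use \<alpha> in \<open>auto simp: admissible_def\<close>)
qed

lemma swap_f_Delta3:
  assumes "admissible \<alpha>"
  shows "swap_f (Delta3 \<alpha>) = Delta3 (\<lambda>i. digit_swap (\<alpha> i))"
proof -
  have "Delta3 \<alpha> \<in> {0..1}"
    using assms Delta3_nonneg Delta3_le_1 by (auto simp: admissible_def)
  then have "digits_of (Delta3 \<alpha>) = \<alpha>"
    unfolding digits_of_def using assms by (intro the1_equality ex1_admissible) auto
  then show ?thesis by (simp add: swap_f_def)
qed

lemma swap_f_in_unit_interval: "swap_f x \<in> {0..1}"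
proof -
  have "ternary_digits (\<lambda>i. digit_swap (digits_of x i))" by (simp add: ternary_digits_def digit_swap_def)
  then show ?thesis using Delta3_nonneg Delta3_le_1 by (simp add: swap_f_def)
qed

lemma Delta3_second_expansion:
  assumes "terminates_at \<alpha> n"
  shows "Delta3 (\<lambda>i. if i < n - 1 then \<alpha> i else if i = n - 1 then \<alpha> i - 1 else 2) = Delta3 \<alpha>"
  using assms
proof (induction n arbitrary: \<alpha>)
  case 0
  then show ?case by (simp add: terminates_at_def)
next
  case (Suc n)
  let ?\<beta> = "\<lambda>n \<alpha> i. if i < n - 1 then \<alpha> i else if i = n - 1 then \<alpha> i - 1 else (2::nat)"
  have \<alpha>: "ternary_digits \<alpha>" using Suc.prems by (simp add: terminates_at_def)
  have \<beta>: "ternary_digits (?\<beta> (Suc n) \<alpha>)"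
    unfolding ternary_digits_def
  proof
    fix i show "?\<beta> (Suc n) \<alpha> i \<in> {0, 1, 2}"
      using \<alpha>[unfolded ternary_digits_def, rule_format, of i] by auto
  qed
  show ?case
  proof (cases n)
    case 0
    then have "Delta3 (\<lambda>i. \<alpha> (Suc i)) = 0" "\<alpha> 0 \<noteq> 0"
      using Suc.prems by (auto simp: terminates_at_def Delta3_def)
    then show ?thesis
      using Delta3_Suc[OF \<alpha>] Delta3_Suc[OF \<beta>] 0 by (simp add: Delta3_twos of_nat_diff field_simps)
  next
    case (Suc m)
    have "terminates_at (\<lambda>i. \<alpha> (Suc i)) n"
      using Suc.prems Suc by (simp add: terminates_at_def ternary_digits_def)
    from Suc.IH[OF this] show ?thesis
      using Delta3_Suc[OF \<alpha>] Delta3_Suc[OF \<beta>] Suc by (simp cong: if_cong)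
  qed
qed

end

theory Submission
  imports Defs
begin

text \<open>
  For every \<open>N\<close> the map carries the points whose expansion starts with
  \<open>\<alpha>\<^sub>1, \<dots>, \<alpha>\<^sub>N\<close> into an interval of length \<open>3\<^sup>-\<^sup>N\<close>.  These points fill the open triadic interval to
  the right of \<open>\<Delta>\<^sup>3(\<alpha>\<^sub>1 \<dots> \<alpha>\<^sub>N 0 0 \<dots>)\<close>, and that interval
  is a right neighbourhood of \<open>\<Delta>\<^sup>3(\<alpha>)\<close> as long as \<open>\<alpha>\<close> does not end in
  2s, a left neighbourhood as long as \<open>\<alpha>\<close> does not end in 0s.  So each one-sided limit is read
  off digitwise from an expansion of the matching kind.  The two kinds can be served by the same
  expansion exactly at the ternary-irrational points of \<open>(0,1)\<close>; at a ternary-rational point the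
  two expansions have digitwise images that differ by the stated jump.
\<close>

section \<open>Prefixes and tails of expansions\<close>

lemma ternary_digits_shift: "ternary_digits \<alpha> \<Longrightarrow> ternary_digits (\<lambda>i. \<alpha> (i + N))"
  by (simp add: ternary_digits_def)

lemma ternary_digits_digit_swap: "ternary_digits (\<lambda>i. digit_swap (\<alpha> i))"
  by (simp add: ternary_digits_def digit_swap_def)

text \<open>The left endpoint of the triadic interval of length \<open>1 / 3 ^ N\<close> that
  belongs to the first \<open>N\<close> digits.\<close>

definition Delta3_prefix :: "(nat \<Rightarrow> nat) \<Rightarrow> nat \<Rightarrow> real" where
  "Delta3_prefix \<alpha> N = (\<Sum>i<N. real (\<alpha> i) / 3 ^ Suc i)"

lemma Delta3_split:
  assumes "ternary_digits \<alpha>"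
  shows "Delta3 \<alpha> = Delta3_prefix \<alpha> N + Delta3 (\<lambda>i. \<alpha> (i + N)) / 3 ^ N"
proof -
  have "Delta3 (\<lambda>i. \<alpha> (i + N)) / 3 ^ N = (\<Sum>i. real (\<alpha> (i + N)) / 3 ^ Suc (i + N))"
    unfolding Delta3_def
    by (subst suminf_divide[OF summable_Delta3[OF ternary_digits_shift[OF assms]], symmetric])
       (simp add: field_simps power_add)
  then show ?thesis
    using suminf_split_initial_segment[OF summable_Delta3[OF assms], of N]
    by (simp add: Delta3_def Delta3_prefix_def)
qed

lemma Delta3_prefix_Suc_shift:
  "Delta3_prefix \<alpha> (Suc N) = (real (\<alpha> 0) + Delta3_prefix (\<lambda>i. \<alpha> (Suc i)) N) / 3"
  unfolding Delta3_prefix_def sum.lessThan_Suc_shift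
  by (simp add: sum_divide_distrib add_divide_distrib mult.commute)

lemma Delta3_prefix_nonneg: "0 \<le> Delta3_prefix \<alpha> N"
  unfolding Delta3_prefix_def by (intro sum_nonneg) simp

text \<open>Appending a digit raises the left endpoint by at most \<open>2 / 3 ^ Suc N\<close>,
  exactly the amount by which the length shrinks, so right endpoints never move to the
  right.\<close>

lemma Delta3_prefix_le:
  assumes "ternary_digits \<alpha>"
  shows "Delta3_prefix \<alpha> N + 1 / 3 ^ N \<le> 1"
proof (induction N)
  case 0
  then show ?case by (simp add: Delta3_prefix_def)
next
  case (Suc N)
  then show ?case
    using Delta3_term_le[OF assms, of N] by (simp add: Delta3_prefix_def field_simps)
qed

text \<open>After multiplication by 3 the bounds put the first digits less than 1 apart, so they
  coincide; cancelling them leaves the same situation for the shifted sequences. The inequalities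
  are strict because an endpoint may have a second expansion with another prefix.\<close>

lemma Delta3_cylinder:
  assumes "ternary_digits \<alpha>" "ternary_digits \<beta>"
    and "Delta3_prefix \<alpha> N < Delta3 \<beta>" "Delta3 \<beta> < Delta3_prefix \<alpha> N + 1 / 3 ^ N"
    and "i < N"
  shows "\<beta> i = \<alpha> i"
  using assms
proof (induction N arbitrary: \<alpha> \<beta> i)
  case 0
  then show ?case by simp
next
  case (Suc N)
  let ?\<alpha> = "\<lambda>i. \<alpha> (Suc i)" and ?\<beta> = "\<lambda>i. \<beta> (Suc i)"
  have digits: "ternary_digits ?\<alpha>" "ternary_digits ?\<beta>"
    using Suc.prems ternary_digits_Suc by blast+
  have lower: "real (\<alpha> 0) + Delta3_prefix ?\<alpha> N < real (\<beta> 0) + Delta3 ?\<beta>"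
    using Suc.prems(3) Delta3_Suc[OF Suc.prems(2)] by (simp add: Delta3_prefix_Suc_shift)
  have upper: "real (\<beta> 0) + Delta3 ?\<beta> < real (\<alpha> 0) + (Delta3_prefix ?\<alpha> N + 1 / 3 ^ N)"
    using Suc.prems(4) Delta3_Suc[OF Suc.prems(2)]
    by (simp add: Delta3_prefix_Suc_shift field_simps)
  have "real (\<alpha> 0) < real (\<beta> 0) + 1" "real (\<beta> 0) < real (\<alpha> 0) + 1"
    using lower upper Delta3_prefix_nonneg[of ?\<alpha> N] Delta3_prefix_le[OF digits(1), of N]
      Delta3_nonneg[OF digits(2)] Delta3_le_1[OF digits(2)] by linarith+
  then have "\<alpha> 0 = \<beta> 0" by linarith
  then show ?case
    using Suc.IH[OF digits, of "i - 1"] lower upper Suc.prems(5) by (cases i) simp_all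
qed

text \<open>The prefixes cancel, leaving the difference of two tails from \<open>{0..1}\<close>,
  scaled by \<open>1 / 3 ^ N\<close>.\<close>

lemma Delta3_common_prefix:
  assumes "ternary_digits \<alpha>" "ternary_digits \<beta>" "\<And>i. i < N \<Longrightarrow> \<alpha> i = \<beta> i"
  shows "\<bar>Delta3 \<alpha> - Delta3 \<beta>\<bar> \<le> 1 / 3 ^ N"
proof -
  let ?a = "Delta3 (\<lambda>i. \<alpha> (i + N))" and ?b = "Delta3 (\<lambda>i. \<beta> (i + N))"
  have "Delta3_prefix \<alpha> N = Delta3_prefix \<beta> N"
    using assms(3) by (simp add: Delta3_prefix_def)
  then have "Delta3 \<alpha> - Delta3 \<beta> = (?a - ?b) / 3 ^ N"
    using Delta3_split[OF assms(1), of N] Delta3_split[OF assms(2), of N]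
    by (simp add: diff_divide_distrib)
  moreover have "\<bar>?a - ?b\<bar> \<le> 1"
    using Delta3_nonneg[of "\<lambda>i. \<alpha> (i + N)"] Delta3_nonneg[of "\<lambda>i. \<beta> (i + N)"]
      Delta3_le_1[of "\<lambda>i. \<alpha> (i + N)"] Delta3_le_1[of "\<lambda>i. \<beta> (i + N)"]
      ternary_digits_shift[OF assms(1), of N] ternary_digits_shift[OF assms(2), of N]
    by linarith
  ultimately show ?thesis by (simp add: abs_divide divide_right_mono)
qed

lemma Delta3_eq_0D:
  assumes "ternary_digits \<alpha>" "Delta3 \<alpha> = 0"
  shows "\<alpha> i = 0"
proof -
  have "real (\<alpha> i) / 3 ^ Suc i = 0"
    using suminf_eq_zero_iff[OF summable_Delta3[OF assms(1)]] assms(2)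
    by (auto simp: Delta3_def)
  then show ?thesis by simp
qed

text \<open>Equality would force the tail after \<open>N\<close> digits to be 0, hence to consist of
  0s only.\<close>

lemma Delta3_prefix_less:
  assumes "ternary_digits \<alpha>" "\<not> (\<exists>N. \<forall>i\<ge>N. \<alpha> i = 0)"
  shows "Delta3_prefix \<alpha> N < Delta3 \<alpha>"
proof -
  have "Delta3 (\<lambda>i. \<alpha> (i + N)) \<noteq> 0"
    using Delta3_eq_0D[OF ternary_digits_shift[OF assms(1), of N]] assms(2)
    by (metis le_add_diff_inverse2)
  then show ?thesis
    using Delta3_split[OF assms(1), of N] Delta3_nonneg[OF ternary_digits_shift[OF assms(1), of N]]
    by simp
qed

text \<open>Equality would force the tail after \<open>N\<close> digits to be 1, hence to consist of
  2s only.\<close>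

lemma Delta3_less_prefix:
  assumes "ternary_digits \<alpha>" "\<not> (\<exists>N. \<forall>i\<ge>N. \<alpha> i = 2)"
  shows "Delta3 \<alpha> < Delta3_prefix \<alpha> N + 1 / 3 ^ N"
proof -
  have "Delta3 (\<lambda>i. \<alpha> (i + N)) \<noteq> 1"
    using Delta3_eq_1D[OF ternary_digits_shift[OF assms(1), of N]] assms(2)
    by (metis le_add_diff_inverse2)
  then have "Delta3 (\<lambda>i. \<alpha> (i + N)) < 1"
    using Delta3_le_1[OF ternary_digits_shift[OF assms(1), of N]] by simp
  then show ?thesis
    using Delta3_split[OF assms(1), of N] by (simp add: divide_strict_right_mono)
qed

lemma Delta3_prefix_bounds:
  assumes "ternary_digits \<alpha>"
  shows "Delta3_prefix \<alpha> N \<le> Delta3 \<alpha>" "Delta3 \<alpha> \<le> Delta3_prefix \<alpha> N + 1 / 3 ^ N"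
  using Delta3_split[OF assms, of N] Delta3_nonneg[OF ternary_digits_shift[OF assms, of N]]
    Delta3_le_1[OF ternary_digits_shift[OF assms, of N]]
  by (simp_all add: divide_right_mono)

section \<open>One-sided limits of the map\<close>

text \<open>\<open>swap_f\<close> reads the admissible expansion of \<open>x\<close>, which shares
  its first \<open>N\<close> digits with \<alpha>; hence so do the images. Here \<alpha> itself may
  end in 2s, as is required for left limits at ternary-rational points.\<close>

lemma swap_f_cylinder:
  assumes "ternary_digits \<alpha>"
    and "Delta3_prefix \<alpha> N < x" "x < Delta3_prefix \<alpha> N + 1 / 3 ^ N"
  shows "\<bar>swap_f x - Delta3 (\<lambda>i. digit_swap (\<alpha> i))\<bar> \<le> 1 / 3 ^ N"
proof -
  have "x \<in> {0..1}"
    using assms(2,3) Delta3_prefix_nonneg[of \<alpha> N] Delta3_prefix_le[OF assms(1), of N] by simp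
  then obtain \<beta> where \<beta>: "admissible \<beta>" "Delta3 \<beta> = x"
    using ex1_admissible by blast
  then have "\<beta> i = \<alpha> i" if "i < N" for i
    using Delta3_cylinder[OF assms(1) _ _ _ that] assms(2,3) by (simp add: admissible_def)
  then show ?thesis
    unfolding \<beta>(2)[symmetric] swap_f_Delta3[OF \<beta>(1)]
    by (intro Delta3_common_prefix ternary_digits_digit_swap) simp
qed

text \<open>The filter is left general so that limits from the right and from the left both
  follow.\<close>

lemma tendsto_swap_fI:
  assumes "ternary_digits \<alpha>"
    and "\<And>N. \<forall>\<^sub>F x in F. Delta3_prefix \<alpha> N < x \<and> x < Delta3_prefix \<alpha> N + 1 / 3 ^ N"
  shows "(swap_f \<longlongrightarrow> Delta3 (\<lambda>i. digit_swap (\<alpha> i))) F"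
proof (rule tendstoI)
  fix e :: real assume "0 < e"
  then obtain N where N: "(1 / 3) ^ N < e"
    using real_arch_pow_inv[of e "1 / 3"] by auto
  show "\<forall>\<^sub>F x in F. dist (swap_f x) (Delta3 (\<lambda>i. digit_swap (\<alpha> i))) < e"
    using assms(2)[of N]
  proof eventually_elim
    case (elim x)
    then show ?case
      using swap_f_cylinder[OF assms(1), of N x] N by (simp add: dist_real_def power_one_over)
  qed
qed

lemma swap_f_tendsto_at_right:
  assumes "ternary_digits \<alpha>" "\<not> (\<exists>N. \<forall>i\<ge>N. \<alpha> i = 2)"
  shows "(swap_f \<longlongrightarrow> Delta3 (\<lambda>i. digit_swap (\<alpha> i))) (at_right (Delta3 \<alpha>))"
proof (rule tendsto_swap_fI[OF assms(1)])
  fix N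
  show "\<forall>\<^sub>F x in at_right (Delta3 \<alpha>). Delta3_prefix \<alpha> N < x \<and> x < Delta3_prefix \<alpha> N + 1 / 3 ^ N"
    using eventually_at_right_real[OF Delta3_less_prefix[OF assms, of N]]
    by eventually_elim (use Delta3_prefix_bounds[OF assms(1), of N] in auto)
qed

lemma swap_f_tendsto_at_left:
  assumes "ternary_digits \<alpha>" "\<not> (\<exists>N. \<forall>i\<ge>N. \<alpha> i = 0)"
  shows "(swap_f \<longlongrightarrow> Delta3 (\<lambda>i. digit_swap (\<alpha> i))) (at_left (Delta3 \<alpha>))"
proof (rule tendsto_swap_fI[OF assms(1)])
  fix N
  show "\<forall>\<^sub>F x in at_left (Delta3 \<alpha>). Delta3_prefix \<alpha> N < x \<and> x < Delta3_prefix \<alpha> N + 1 / 3 ^ N"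
    using eventually_at_left_real[OF Delta3_prefix_less[OF assms, of N]]
    by eventually_elim (use Delta3_prefix_bounds[OF assms(1), of N] in auto)
qed

section \<open>Continuity at ternary-irrational points\<close>

text \<open>\<open>terminates_at\<close> asks for the exact position of the last nonzero digit: it
  is the least index from which all digits vanish. The nonzero digit \<open>\<alpha> j\<close> makes
  this index positive.\<close>

lemma ternary_rationalI:
  assumes "ternary_digits \<alpha>" "\<alpha> j \<noteq> 0" "\<forall>i\<ge>N. \<alpha> i = 0"
  shows "ternary_rational (Delta3 \<alpha>)"
proof -
  define n where "n = (LEAST n. \<forall>i\<ge>n. \<alpha> i = 0)"
  have zero: "\<forall>i\<ge>n. \<alpha> i = 0"
    unfolding n_def using assms(3) by (rule LeastI)
  then have "n \<ge> 1" using assms(2) by (cases n) auto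
  moreover have "\<alpha> (n - 1) \<noteq> 0"
  proof
    assume "\<alpha> (n - 1) = 0"
    have "\<alpha> i = 0" if "i \<ge> n - 1" for i
      using that zero \<open>\<alpha> (n - 1) = 0\<close> by (cases "i = n - 1") auto
    then have "\<forall>i\<ge>n - 1. \<alpha> i = 0" by blast
    then have "n \<le> n - 1" unfolding n_def by (rule Least_le)
    then show False using \<open>n \<ge> 1\<close> by simp
  qed
  ultimately show ?thesis
    using zero assms(1) by (auto simp: ternary_rational_def terminates_at_def)
qed

lemma swap_f_continuous_at_ternary_irrational:
  assumes "ternary_irrational x"
  shows "continuous (at x within {0..1}) swap_f"
proof -
  obtain \<alpha> where \<alpha>: "admissible \<alpha>" "x = Delta3 \<alpha>"
    using assms ex1_admissible[of x] by (auto simp: ternary_irrational_def)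
  have digits: "ternary_digits \<alpha>" using \<alpha> by (simp add: admissible_def)
  have swap_f_x: "swap_f x = Delta3 (\<lambda>i. digit_swap (\<alpha> i))"
    unfolding \<alpha>(2) by (rule swap_f_Delta3[OF \<alpha>(1)])
  \<comment> \<open>An expansion that ends in 0s but has a nonzero digit would make \<open>x\<close>
    ternary-rational.\<close>
  have "(\<forall>i. \<alpha> i = 0) \<or> \<not> (\<exists>N. \<forall>i\<ge>N. \<alpha> i = 0)"
    using \<alpha>(2) assms ternary_rationalI[OF digits] unfolding ternary_irrational_def by blast
  \<comment> \<open>The first two cases are the endpoints 0 and 1, where only one side lies in the
    domain; in the third, \<alpha> yields both one-sided limits.\<close>
  then consider "\<forall>i. \<alpha> i = 0" | "\<forall>i. \<alpha> i = 2"
    | "\<not> (\<exists>N. \<forall>i\<ge>N. \<alpha> i = 2)" "\<not> (\<exists>N. \<forall>i\<ge>N. \<alpha> i = 0)"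
    using \<alpha>(1) unfolding admissible_def by blast
  then show ?thesis
  proof cases
    case 1
    then have "x = 0" using \<alpha>(2) by (simp add: Delta3_def)
    moreover have "(swap_f \<longlongrightarrow> swap_f x) (at_right x)"
      unfolding swap_f_x unfolding \<alpha>(2) by (rule swap_f_tendsto_at_right[OF digits]) (use 1 in auto)
    ultimately show ?thesis
      by (simp add: continuous_within at_within_Icc_at_right)
  next
    case 2
    then have "x = 1" using \<alpha>(2) by (simp add: Delta3_twos)
    moreover have "(swap_f \<longlongrightarrow> swap_f x) (at_left x)"
      unfolding swap_f_x unfolding \<alpha>(2) by (rule swap_f_tendsto_at_left[OF digits]) (use 2 in auto)
    ultimately show ?thesis
      by (simp add: continuous_within at_within_Icc_at_left)
  next
    case 3
    have "(swap_f \<longlongrightarrow> swap_f x) (at x)"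
      unfolding swap_f_x unfolding \<alpha>(2)
      by (intro filterlim_split_at swap_f_tendsto_at_left swap_f_tendsto_at_right digits 3)
    then show ?thesis
      unfolding continuous_within by (rule tendsto_within_subset) simp
  qed
qed

section \<open>The jump at ternary-rational points\<close>

text \<open>The constant sequence is its own shift, so its value \<open>s\<close> solves
  \<open>s = 1 / 3 + s / 3\<close>. It is the digitwise image of a tail of 2s.\<close>

lemma Delta3_ones: "Delta3 (\<lambda>_. 1) = 1 / 2"
  using Delta3_Suc[of "\<lambda>_. 1"] by (simp add: ternary_digits_def)

lemma swap_f_one_sided_limits:
  assumes "terminates_at \<alpha> n"
  obtains R L where "(swap_f \<longlongrightarrow> R) (at_right (Delta3 \<alpha>))" "(swap_f \<longlongrightarrow> L) (at_left (Delta3 \<alpha>))"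
    "R - L = (if \<alpha> (n - 1) = 1 then 1 else - 1) / (2 * 3 ^ (n - 1))"
    "0 < Delta3 \<alpha>" "Delta3 \<alpha> < 1"
proof -
  \<comment> \<open>\<open>m\<close> is the index, counted from 0, of the last nonzero
    digit.\<close>
  obtain m where n: "n = Suc m"
    using assms by (cases n) (auto simp: terminates_at_def)
  have digits: "ternary_digits \<alpha>" and \<alpha>_m: "\<alpha> m \<noteq> 0" and \<alpha>_0: "\<And>i. i \<ge> Suc m \<Longrightarrow> \<alpha> i = 0"
    using assms by (auto simp: n terminates_at_def)
  have \<alpha>_12: "\<alpha> m = 1 \<or> \<alpha> m = 2"
    using digits[unfolded ternary_digits_def, rule_format, of m] \<alpha>_m by simp
  \<comment> \<open>The second expansion of the same point; it ends in 2s and therefore gives the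
    left limit.\<close>
  define \<beta> where "\<beta> = (\<lambda>i. if i < m then \<alpha> i else if i = m then \<alpha> i - 1 else 2)"
  have \<beta>_digits: "ternary_digits \<beta>"
    unfolding ternary_digits_def
  proof
    fix i show "\<beta> i \<in> {0, 1, 2}"
      using digits[unfolded ternary_digits_def, rule_format, of i] by (auto simp: \<beta>_def)
  qed
  have \<beta>: "Delta3 \<beta> = Delta3 \<alpha>"
    using Delta3_second_expansion[OF assms] by (simp add: n \<beta>_def cong: if_cong)
  have \<alpha>2: "\<not> (\<exists>N. \<forall>i\<ge>N. \<alpha> i = 2)"
  proof
    assume "\<exists>N. \<forall>i\<ge>N. \<alpha> i = 2"
    then obtain N where "\<forall>i\<ge>N. \<alpha> i = 2" ..
    then have "\<alpha> (N + Suc m) = 2" by simp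
    then show False using \<alpha>_0[of "N + Suc m"] by simp
  qed
  have \<beta>0: "\<not> (\<exists>N. \<forall>i\<ge>N. \<beta> i = 0)"
  proof
    assume "\<exists>N. \<forall>i\<ge>N. \<beta> i = 0"
    then obtain N where "\<forall>i\<ge>N. \<beta> i = 0" ..
    then have "\<beta> (N + Suc m) = 0" by simp
    then show False by (simp add: \<beta>_def)
  qed
  let ?R = "Delta3 (\<lambda>i. digit_swap (\<alpha> i))" and ?L = "Delta3 (\<lambda>i. digit_swap (\<beta> i))"
  have "Delta3 (\<lambda>i. digit_swap (\<alpha> (i + Suc m))) = 0"
    using \<alpha>_0 by (simp add: Delta3_def digit_swap_def)
  then have R: "?R = Delta3_prefix (\<lambda>i. digit_swap (\<alpha> i)) m + digit_swap (\<alpha> m) / 3 ^ Suc m"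
    using Delta3_split[OF ternary_digits_digit_swap, of \<alpha> "Suc m"]
    by (simp add: Delta3_prefix_def)
  have "(\<lambda>i. digit_swap (\<beta> (i + Suc m))) = (\<lambda>_. 1)"
    by (auto simp: \<beta>_def digit_swap_def)
  then have "Delta3 (\<lambda>i. digit_swap (\<beta> (i + Suc m))) = 1 / 2"
    by (simp only: Delta3_ones)
  then have L: "?L = Delta3_prefix (\<lambda>i. digit_swap (\<beta> i)) m
      + digit_swap (\<beta> m) / 3 ^ Suc m + 1 / 2 / 3 ^ Suc m"
    using Delta3_split[OF ternary_digits_digit_swap, of \<beta> "Suc m"]
    by (simp add: Delta3_prefix_def field_simps)
  have "Delta3_prefix (\<lambda>i. digit_swap (\<alpha> i)) m = Delta3_prefix (\<lambda>i. digit_swap (\<beta> i)) m"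
    by (simp add: Delta3_prefix_def \<beta>_def)
  \<comment> \<open>In units of \<open>1 / 3 ^ Suc m\<close> the jump is
    \<open>2 - 0 - 1 / 2 = 3 / 2\<close> if the last nonzero digit is 1, and
    \<open>1 - 2 - 1 / 2 = - 3 / 2\<close> if it is 2.\<close>
  then have jump: "?R - ?L = (if \<alpha> m = 1 then 1 else - 1) / (2 * 3 ^ m)"
    unfolding R L using \<alpha>_12 by (auto simp: \<beta>_def digit_swap_def field_simps)
  show thesis
  proof (rule that)
    show "(swap_f \<longlongrightarrow> ?R) (at_right (Delta3 \<alpha>))"
      by (rule swap_f_tendsto_at_right[OF digits \<alpha>2])
    show "(swap_f \<longlongrightarrow> ?L) (at_left (Delta3 \<alpha>))"
      using swap_f_tendsto_at_left[OF \<beta>_digits \<beta>0] by (simp add: \<beta>)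
    show "0 < Delta3 \<alpha>"
      using Delta3_prefix_less[OF \<beta>_digits \<beta>0, of 0] by (simp add: \<beta> Delta3_prefix_def)
    show "Delta3 \<alpha> < 1"
      using Delta3_less_prefix[OF digits \<alpha>2, of 0] by (simp add: Delta3_prefix_def)
  qed (use jump n in simp)
qed

text \<open>The point is interior, so continuity would make both one-sided limits equal to
  \<open>swap_f x\<close>, against the nonzero jump.\<close>

lemma swap_f_discontinuous_at_ternary_rational:
  assumes "ternary_rational x"
  shows "\<not> continuous (at x within {0..1}) swap_f"
proof
  assume cont: "continuous (at x within {0..1}) swap_f"
  obtain \<alpha> n where \<alpha>: "terminates_at \<alpha> n" "x = Delta3 \<alpha>"
    using assms by (auto simp: ternary_rational_def)
  from swap_f_one_sided_limits[OF \<alpha>(1), folded \<alpha>(2)] obtain R L where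
    lim: "(swap_f \<longlongrightarrow> R) (at_right x)" "(swap_f \<longlongrightarrow> L) (at_left x)"
    and jump: "R - L = (if \<alpha> (n - 1) = 1 then 1 else - 1) / (2 * 3 ^ (n - 1))"
    and x: "0 < x" "x < 1" .
  have "at x within {0..1} = at x"
    using x by (intro at_within_interior) simp
  then have "(swap_f \<longlongrightarrow> swap_f x) (at x)"
    using cont by (simp add: continuous_within)
  then have "(swap_f \<longlongrightarrow> swap_f x) (at_right x)" "(swap_f \<longlongrightarrow> swap_f x) (at_left x)"
    by (auto simp: filterlim_at_split)
  then have "R = swap_f x" "L = swap_f x"
    using lim tendsto_unique trivial_limit_at_right_real trivial_limit_at_left_real by blast+
  then show False using jump by (simp split: if_splits)
qed

theorem theorem2:
  shows "(\<forall>x. ternary_irrational x \<longrightarrow> continuous (at x within {0..1}) swap_f) \<and>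
    (\<forall>x. ternary_rational x \<longrightarrow> \<not> continuous (at x within {0..1}) swap_f) \<and>
    (\<forall>\<alpha> n. terminates_at \<alpha> n \<longrightarrow>
       (\<exists>R L. (swap_f \<longlongrightarrow> R) (at_right (Delta3 \<alpha>)) \<and> (swap_f \<longlongrightarrow> L) (at_left (Delta3 \<alpha>)) \<and>
          (\<alpha> (n - 1) = 1 \<longrightarrow> R - L = 1 / (2 * 3 ^ (n - 1))) \<and>
          (\<alpha> (n - 1) = 2 \<longrightarrow> R - L = - (1 / (2 * 3 ^ (n - 1))))))"
proof (intro conjI allI impI)
  fix \<alpha> n assume "terminates_at \<alpha> n"
  from swap_f_one_sided_limits[OF this] obtain R L where
    "(swap_f \<longlongrightarrow> R) (at_right (Delta3 \<alpha>))" "(swap_f \<longlongrightarrow> L) (at_left (Delta3 \<alpha>))"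
    "R - L = (if \<alpha> (n - 1) = 1 then 1 else - 1) / (2 * 3 ^ (n - 1))" .
  then show "\<exists>R L. (swap_f \<longlongrightarrow> R) (at_right (Delta3 \<alpha>)) \<and>
      (swap_f \<longlongrightarrow> L) (at_left (Delta3 \<alpha>)) \<and>
      (\<alpha> (n - 1) = 1 \<longrightarrow> R - L = 1 / (2 * 3 ^ (n - 1))) \<and>
      (\<alpha> (n - 1) = 2 \<longrightarrow> R - L = - (1 / (2 * 3 ^ (n - 1))))"
    by (intro exI[of _ R] exI[of _ L]) auto
qed (use swap_f_continuous_at_ternary_irrational swap_f_discontinuous_at_ternary_rational in auto)

end
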